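(* Let $0<q<1$, let $m,n$ be nonnegative integers and let $x$ be a real number such that $x+i+j+m-1\neq 0$ for all $0\le i,j\le n-1$. Define $$B_n(x,m,q)=\left(q^{\binom{i-j+m}{2}}\frac{[2i+x+2m-1]}{[i+j+x+m-1]}\begin{bmatrix}i+j+x+m-1\\ i-j+m\end{bmatrix}\right)_{i,j=0}^{n-1},\qquad H_m(x,n,q)=\left(h_{n-i+j}(x+2i,q)\right)_{i,j=0}^{m-1},$$ where $h_\ell(y,q)=\begin{bmatrix}2\ell+y-1\\ \ell\end{bmatrix}$. Then $$\det B_n(x,m,q)=q^{n\binom{m}{2}}\frac{1}{(1-q)^{mn}}\prod_{j=0}^{m-1}\frac{[j]!}{[n+j]!}\prod_{j=1}^{n}\left(q^{x+2j-2};q\right)_{m-j}\left(q^{x+2m+j-2};q\right)_{j}=\det H_m(x,n,q).$$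
   Context: For real $a$, $[a]=\frac{1-q^a}{1-q}$; $[r]!=[1][2]\cdots[r]$ for integers $r\ge0$. For real $y$ and integer $r$, $\begin{bmatrix}y\\ r\end{bmatrix}=\prod_{l=1}^{r}\frac{1-q^{y-r+l}}{1-q^{l}}$ if $r\ge0$ and $0$ if $r<0$. $(a;q)_r=\prod_{l=0}^{r-1}(1-aq^l)$ for $r\ge0$ and $(a;q)_{r}=1/(aq^{r};q)_{-r}$ for $r<0$. $\binom{a}{2}=a(a-1)/2$. Empty products and $0\times0$ determinants equal $1$. *)

theory Defs
  imports Complex_Main "Jordan_Normal_Form.Determinant"
begin

text \<open>
  All notions carry the base \<open>q\<close> as an explicit first argument. They have the intended
  meaning for \<open>0 < q < 1\<close>; real exponents of \<open>q\<close> are rendered with \<open>powr\<close>.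
\<close>

definition qnum :: "real \<Rightarrow> real \<Rightarrow> real" where
  "qnum q a = (1 - q powr a) / (1 - q)"

definition qfact :: "real \<Rightarrow> nat \<Rightarrow> real" where
  "qfact q r = (\<Prod>k=1..r. qnum q (real k))"

definition qbinom :: "real \<Rightarrow> real \<Rightarrow> int \<Rightarrow> real" where
  "qbinom q y r =
     (if r \<ge> 0
      then \<Prod>l=1..nat r. (1 - q powr (y - of_int r + real l)) / (1 - q ^ l)
      else 0)"

definition qpoch_nat :: "real \<Rightarrow> real \<Rightarrow> nat \<Rightarrow> real" where
  "qpoch_nat q a r = (\<Prod>l<r. 1 - a * q ^ l)"

text \<open>\<open>qpoch q a r\<close> is the shifted factorial \<open>(a;q)\<close> with integer index \<open>r\<close>.\<close>

definition qpoch :: "real \<Rightarrow> real \<Rightarrow> int \<Rightarrow> real" where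
  "qpoch q a r =
     (if r \<ge> 0 then qpoch_nat q a (nat r)
      else 1 / qpoch_nat q (a * q powi r) (nat (- r)))"

definition binom2 :: "real \<Rightarrow> real" where
  "binom2 a = a * (a - 1) / 2"

definition hq :: "real \<Rightarrow> int \<Rightarrow> real \<Rightarrow> real" where
  "hq q l y = qbinom q (2 * of_int l + y - 1) l"

definition B_mat :: "nat \<Rightarrow> real \<Rightarrow> nat \<Rightarrow> real \<Rightarrow> real mat" where
  "B_mat n x m q = mat n n (\<lambda>(i, j).
     q powr binom2 (of_int (int i - int j + int m))
     * (qnum q (2 * real i + x + 2 * real m - 1) / qnum q (real i + real j + x + real m - 1))
     * qbinom q (real i + real j + x + real m - 1) (int i - int j + int m))"

definition H_mat :: "nat \<Rightarrow> real \<Rightarrow> nat \<Rightarrow> real \<Rightarrow> real mat" where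
  "H_mat m x n q = mat m m (\<lambda>(i, j). hq q (int n - int i + int j) (x + 2 * real i))"

end

theory Submission
  imports Defs "HOL-Computational_Algebra.Polynomial"
begin

text \<open>
  Put \<open>Y = q\<^sup>x\<^sup>-\<^sup>1\<close>, \<open>P k = (Y; q)\<^sub>k\<close> and \<open>Q k = (q; q)\<^sub>k\<close>. For \<open>x\<close> not an integer no
  \<open>P k\<close> vanishes, and both determinants become polynomial evaluations up to row and column factors.

  With \<open>z N = q\<^sup>-\<^sup>N + Y q\<^sup>N\<close>, the \<open>(i, j)\<close> entry of \<open>B\<close> is
  \<open>R (i + m) * S j * (\<Prod>l<j. z (i + m) - z l)\<close>, a Newton basis evaluated at the points
  \<open>z (i + m)\<close>, so that its determinant is a Vandermonde product whose factors split.

  The \<open>(i, j)\<close> entry of \<open>H\<close> is \<open>u n j * p i (q\<^sup>n\<^sup>+\<^sup>j)\<close> with \<open>p i\<close> of degree less than \<open>m\<close>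
  and independent of \<open>n\<close>. Passing from \<open>n = 0\<close>, where \<open>H\<close> is unitriangular, to general \<open>n\<close>
  dilates the points by \<open>q\<^sup>n\<close>, which multiplies the determinant by \<open>q\<close> to the power
  \<open>n (m choose 2)\<close>.

  Integer values of \<open>x\<close> follow by continuity from the right.
\<close>

section \<open>Determinants of scaled, polynomial and Newton-basis matrices\<close>

lemma det_scale_rows_cols:
  fixes f :: "nat \<Rightarrow> nat \<Rightarrow> 'a :: comm_ring_1"
  shows "det (mat n n (\<lambda>(i, j). a i * b j * f i j))
           = (\<Prod>i<n. a i) * (\<Prod>j<n. b j) * det (mat n n (\<lambda>(i, j). f i j))"
proof -
  have "(\<Prod>i = 0..<n. a i * b (p i) * f i (p i))
          = (\<Prod>i<n. a i) * (\<Prod>j<n. b j) * (\<Prod>i = 0..<n. f i (p i))"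
    if p: "p permutes {0..<n}" for p
  proof -
    have "(\<Prod>i = 0..<n. b (p i)) = (\<Prod>i = 0..<n. b i)"
      using prod.permute[OF p, of b] by (simp add: comp_def)
    thus ?thesis by (simp add: prod.distrib atLeast0LessThan)
  qed
  moreover have "p i < n" if "p permutes {0..<n}" "i < n" for p i
    using permutes_in_image[OF that(1), of i] that(2) by simp
  ultimately show ?thesis
    by (subst (1 2) det_def') (auto simp: sum_distrib_left mult_ac intro!: sum.cong)
qed

text \<open>The matrix is the Vandermonde matrix of the points times the matrix of coefficients; the
  degree bound makes the latter square.\<close>

lemma det_poly_eval:
  fixes p :: "nat \<Rightarrow> 'a :: idom poly"
  assumes "\<And>j. j < n \<Longrightarrow> degree (p j) < n"
  shows "det (mat n n (\<lambda>(i, j). poly (p j) (z i)))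
           = det (mat n n (\<lambda>(i, k). z i ^ k)) * det (mat n n (\<lambda>(k, j). coeff (p j) k))"
proof -
  have "poly (p j) (z i) = (\<Sum>k<n. z i ^ k * coeff (p j) k)" if "j < n" for i j
  proof -
    have "poly (p j) (z i) = (\<Sum>k\<le>degree (p j). coeff (p j) k * z i ^ k)"
      by (rule poly_altdef)
    also have "\<dots> = (\<Sum>k<n. coeff (p j) k * z i ^ k)"
      using assms[OF that] by (intro sum.mono_neutral_left) (auto simp: coeff_eq_0)
    finally show ?thesis by (simp add: mult.commute)
  qed
  hence "mat n n (\<lambda>(i, j). poly (p j) (z i))
          = mat n n (\<lambda>(i, k). z i ^ k) * mat n n (\<lambda>(k, j). coeff (p j) k)"
    by (intro eq_matI) (auto simp: scalar_prod_def atLeast0LessThan)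
  thus ?thesis by (simp add: det_mult[of _ n])
qed

text \<open>In \<open>det_poly_eval\<close> only the Vandermonde factor sees the points, and
  dilating them multiplies its column \<open>k\<close> by \<open>c ^ k\<close>.\<close>

lemma det_poly_eval_dilate:
  fixes p :: "nat \<Rightarrow> 'a :: idom poly"
  assumes "\<And>j. j < n \<Longrightarrow> degree (p j) < n"
  shows "det (mat n n (\<lambda>(i, j). poly (p j) (c * z i)))
           = c ^ (n choose 2) * det (mat n n (\<lambda>(i, j). poly (p j) (z i)))"
proof -
  have "(\<Prod>k<n. c ^ k) = c ^ (n choose 2)"
    by (induction n) (auto simp: numeral_2_eq_2 power_add)
  moreover have "det (mat n n (\<lambda>(i, k). (c * z i) ^ k))
      = (\<Prod>k<n. c ^ k) * det (mat n n (\<lambda>(i, k). z i ^ k))"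
    using det_scale_rows_cols[of n "\<lambda>_. 1" "\<lambda>k. c ^ k" "\<lambda>i k. z i ^ k"]
    by (simp add: power_mult_distrib)
  ultimately show ?thesis
    using det_poly_eval[of n p, OF assms] by simp
qed

lemma det_mat_upper:
  fixes f :: "nat \<Rightarrow> nat \<Rightarrow> 'a :: idom"
  assumes "\<And>i j. i < n \<Longrightarrow> j < i \<Longrightarrow> f i j = 0"
  shows "det (mat n n (\<lambda>(i, j). f i j)) = (\<Prod>i<n. f i i)"
proof -
  have "det (mat n n (\<lambda>(i, j). f i j)) = prod_list (diag_mat (mat n n (\<lambda>(i, j). f i j)))"
    by (rule det_upper_triangular[of _ n]) (auto intro!: assms)
  thus ?thesis by (simp add: prod_list_diag_prod atLeast0LessThan)
qed

lemma det_mat_lower: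
  fixes f :: "nat \<Rightarrow> nat \<Rightarrow> 'a :: idom"
  assumes "\<And>i j. j < n \<Longrightarrow> i < j \<Longrightarrow> f i j = 0"
  shows "det (mat n n (\<lambda>(i, j). f i j)) = (\<Prod>i<n. f i i)"
proof -
  have "det (mat n n (\<lambda>(i, j). f i j)) = prod_list (diag_mat (mat n n (\<lambda>(i, j). f i j)))"
    by (rule det_lower_triangular[of n]) (auto intro!: assms)
  thus ?thesis by (simp add: prod_list_diag_prod atLeast0LessThan)
qed

lemma
  fixes w :: "nat \<Rightarrow> 'a :: idom"
  shows degree_newton: "degree (\<Prod>l<j. [:- w l, 1:]) = j"
    and coeff_newton: "coeff (\<Prod>l<j. [:- w l, 1:]) j = 1"
proof -
  show *: "degree (\<Prod>l<j. [:- w l, 1:]) = j"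
    by (subst degree_prod_eq_sum_degree) auto
  have "lead_coeff (\<Prod>l<j. [:- w l, 1:]) = 1"
    by (simp add: lead_coeff_prod)
  thus "coeff (\<Prod>l<j. [:- w l, 1:]) j = 1" by (simp only: *)
qed

text \<open>
  A change to another family of monic polynomials is unitriangular, so the nodes \<open>w\<close> may be replaced
  by \<open>z\<close>, which makes the matrix triangular.
\<close>
lemma det_newton:
  fixes w z :: "nat \<Rightarrow> 'a :: idom"
  shows "det (mat n n (\<lambda>(i, j). \<Prod>l<j. z i - w l)) = (\<Prod>i<n. \<Prod>l<i. z i - z l)"
proof -
  have *: "det (mat n n (\<lambda>(i, j). \<Prod>l<j. z i - w l)) = det (mat n n (\<lambda>(i, k). z i ^ k))"
    for w :: "nat \<Rightarrow> 'a"
  proof -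
    define p where "p j = (\<Prod>l<j. [:- w l, 1:])" for j
    have p: "degree (p j) = j" "coeff (p j) j = 1" for j
      using degree_newton[of w j] coeff_newton[of w j] by (auto simp: p_def)
    have "det (mat n n (\<lambda>(k, j). coeff (p j) k)) = 1"
      by (subst det_mat_upper) (auto simp: p intro!: coeff_eq_0)
    moreover have "poly (p j) y = (\<Prod>l<j. y - w l)" for j y
      by (simp add: p_def poly_prod)
    ultimately show ?thesis
      using det_poly_eval[of n p z] by (simp add: p)
  qed
  have "det (mat n n (\<lambda>(i, j). \<Prod>l<j. z i - w l)) = det (mat n n (\<lambda>(i, j). \<Prod>l<j. z i - z l))"
    by (simp only: *)
  also have "\<dots> = (\<Prod>i<n. \<Prod>l<i. z i - z l)"
    by (subst det_mat_lower) auto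
  finally show ?thesis .
qed

section \<open>Shifted factorials and differences of the nodes\<close>

lemma qpoch_nat_0 [simp]: "qpoch_nat q a 0 = 1"
  by (simp add: qpoch_nat_def)

lemma qpoch_nat_Suc: "qpoch_nat q a (Suc r) = qpoch_nat q a r * (1 - a * q ^ r)"
  by (simp add: qpoch_nat_def)

lemma qpoch_nat_add: "qpoch_nat q a (k + r) = qpoch_nat q a k * qpoch_nat q (a * q ^ k) r"
  by (induction r) (auto simp: qpoch_nat_Suc power_add mult_ac)

text \<open>Up to the term \<open>N * j\<close>, the exponent \<open>N - j choose 2\<close>
  separates into a function of \<open>N\<close> and a function of \<open>j\<close>; this is what
  allows powers of \<open>q\<close> to be split between rows and columns.\<close>

lemma choose_two_diff:
  assumes "j \<le> (N :: nat)"
  shows "(N - j choose 2) + N * j = (N choose 2) + (Suc j choose 2)"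
proof -
  \<comment> \<open>This is the case \<open>N = j\<close>, from which the induction on
    \<open>d = N - j\<close> starts.\<close>
  have base: "j * j = (j choose 2) + (Suc j choose 2)"
    by (induction j) (auto simp: numeral_2_eq_2)
  obtain d where N: "N = j + d" using assms le_Suc_ex by blast
  show ?thesis unfolding N using base
    by (induction d) (auto simp: numeral_2_eq_2)
qed

text \<open>\<open>Y\<close> is left free, rather than fixed as a power of \<open>q\<close>, so that
  the locale can be interpreted again at \<open>Y * q ^ (2 * m)\<close>.\<close>

locale generic_qpoch =
  fixes q Y :: real
  assumes q: "0 < q" "q < 1" and Y: "\<And>k. Y * q ^ k \<noteq> 1"
begin

abbreviation "P \<equiv> qpoch_nat q Y"
abbreviation "Q \<equiv> qpoch_nat q q"

lemma P_nz: "P k \<noteq> 0"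
  using Y by (auto simp: qpoch_nat_def)

lemma q_pow_neq_1: "k > 0 \<Longrightarrow> q ^ k \<noteq> 1"
  using q power_less_one_iff[of q k] by simp

lemma Q_nz: "Q k \<noteq> 0"
  using q_pow_neq_1[of "Suc _"] by (auto simp: qpoch_nat_def)

definition z :: "nat \<Rightarrow> real" where "z N = 1 / q ^ N + Y * q ^ N"

lemma z_diff: "z N - z l = (1 - Y * q ^ (N + l)) * (1 - q ^ N / q ^ l) / q ^ N"
  using q by (simp add: z_def field_simps power_add)

text \<open>By \<open>z_diff\<close>, the factors \<open>1 - Y * q ^ (N + l)\<close> build up
  \<open>P (N + j) / P N\<close>, the factors \<open>1 - q ^ (N - l)\<close> build up
  \<open>Q N / Q (N - j)\<close>, and the \<open>j\<close> denominators \<open>q ^ N\<close> give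
  \<open>q ^ (N * j)\<close>.\<close>

lemma prod_z_diff:
  assumes "j \<le> N"
  shows "(\<Prod>l<j. z N - z l) * (P N * Q (N - j) * q ^ (N * j)) = P (N + j) * Q N"
  using assms
proof (induction j)
  case (Suc j)
  define d where "d = N - Suc j"
  have N: "N = Suc (d + j)" using Suc.prems by (simp add: d_def)
  have d: "N - j = Suc d" "N - Suc j = d" using N by simp_all
  have "(z N - z j) * q ^ N = (1 - Y * q ^ (N + j)) * (1 - q * q ^ d)"
    using q by (simp add: z_diff N power_add)
  note step = this
  have "(\<Prod>l<Suc j. z N - z l) * (P N * Q (N - Suc j) * q ^ (N * Suc j))
    = (\<Prod>l<j. z N - z l) * P N * Q d * q ^ (N * j) * ((z N - z j) * q ^ N)"
    by (simp add: d power_add mult_ac)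
  also have "\<dots> = ((\<Prod>l<j. z N - z l) * (P N * Q (N - j) * q ^ (N * j))) * (1 - Y * q ^ (N + j))"
    unfolding step by (simp add: d qpoch_nat_Suc mult_ac)
  also have "\<dots> = P (N + j) * Q N * (1 - Y * q ^ (N + j))"
    using Suc by simp
  finally show ?case by (simp add: qpoch_nat_Suc mult_ac)
qed simp

text \<open>Shifting both indices by \<open>m\<close> amounts to replacing \<open>Y\<close> by
  \<open>Y * q ^ (2 * m)\<close> and dividing by \<open>q ^ m\<close>, so \<open>prod_z_diff\<close>
  with \<open>N = j = i\<close> applies to the new parameter.\<close>

lemma prod_z_diff_shift:
  "(\<Prod>l<i. z (i + m) - z (l + m)) * (P (i + 2 * m) * q ^ ((i + m) * i)) = P (2 * i + 2 * m) * Q i"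
proof -
  interpret s: generic_qpoch q "Y * q ^ (2 * m)"
    using q Y by unfold_locales (auto simp: mult.assoc simp flip: power_add)
  have "z (i + m) - z (l + m) = (s.z i - s.z l) / q ^ m" for l
    unfolding z_def s.z_def using q by (simp add: field_simps power_add power_mult power2_eq_square)
  hence A: "(\<Prod>l<i. z (i + m) - z (l + m)) = (\<Prod>l<i. s.z i - s.z l) / q ^ (m * i)"
    by (simp add: prod_dividef power_mult)
  have P: "P (k + 2 * m) = P (2 * m) * s.P k" for k
    using qpoch_nat_add[of q Y "2 * m" k] by (simp add: add.commute)
  have "(\<Prod>l<i. z (i + m) - z (l + m)) * (P (i + 2 * m) * q ^ ((i + m) * i))
      = P (2 * m) * ((\<Prod>l<i. s.z i - s.z l) * (s.P i * q ^ (i * i)))"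
    unfolding A P add_mult_distrib power_add using q by simp
  also have "(\<Prod>l<i. s.z i - s.z l) * (s.P i * q ^ (i * i)) = s.P (2 * i) * Q i"
    using s.prod_z_diff[of i i] by (simp add: mult_2)
  finally show ?thesis by (simp only: P mult.assoc)
qed

section \<open>The determinant of \<open>B\<close>\<close>

text \<open>The entries of \<open>B\<close> with \<open>Y\<close> in place of
  \<open>q powr (x - 1)\<close>. The denominator \<open>[i+j+x+m-1]\<close> has already been
  cancelled against the last factor of \<open>P (i + m + j + 1)\<close>.\<close>

definition B_gen :: "nat \<Rightarrow> nat \<Rightarrow> real mat" where
  "B_gen n m = mat n n (\<lambda>(i, j). if j \<le> i + m
     then (1 - Y * q ^ (2 * (i + m))) * q ^ (i + m - j choose 2) * P (i + m + j)
            / (P (2 * j + 1) * Q (i + m - j))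
     else 0)"

lemma det_B_gen:
  "det (B_gen n m) = q ^ (n * (m choose 2)) *
     (\<Prod>i<n. P (2 * i + 2 * m + 1) * P (i + m) * Q i / (P (2 * i + 1) * P (i + 2 * m) * Q (i + m)))"
proof -
  define R where "R N = (1 - Y * q ^ (2 * N)) * P N * q ^ (N choose 2) / Q N" for N
  define S where "S j = q ^ (Suc j choose 2) / P (2 * j + 1)" for j
  have entry: "(if j \<le> N
      then (1 - Y * q ^ (2 * N)) * q ^ (N - j choose 2) * P (N + j) / (P (2 * j + 1) * Q (N - j))
      else 0) = R N * S j * (\<Prod>l<j. z N - z l)" for N j
  proof (cases "j \<le> N")
    case True
    have e: "q ^ (N - j choose 2) * q ^ (N * j) = q ^ (N choose 2) * q ^ (Suc j choose 2)"
      using choose_two_diff[OF True] by (simp flip: power_add)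
    have "P (N + j) = (\<Prod>l<j. z N - z l) * (P N * Q (N - j) * q ^ (N * j)) / Q N"
      using prod_z_diff[OF True] Q_nz[of N] by (simp add: field_simps)
    hence "(1 - Y * q ^ (2 * N)) * q ^ (N - j choose 2) * P (N + j) / (P (2 * j + 1) * Q (N - j))
      = (1 - Y * q ^ (2 * N)) * P N / Q N / P (2 * j + 1) * (\<Prod>l<j. z N - z l)
         * (q ^ (N - j choose 2) * q ^ (N * j))"
      using Q_nz[of "N - j"] by (simp add: mult_ac)
    thus ?thesis using True by (simp add: e R_def S_def)
  next
    case False
    \<comment> \<open>The factor \<open>l = N\<close> vanishes, so the Newton product also
      reproduces the zero entries.\<close>
    hence "(\<Prod>l<j. z N - z l) = 0" by (intro prod_zero) auto
    thus ?thesis using False by simp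
  qed
  have "det (B_gen n m) = (\<Prod>i<n. R (i + m)) * (\<Prod>j<n. S j) *
          (\<Prod>i<n. \<Prod>l<i. z (i + m) - z (l + m))"
    unfolding B_gen_def entry by (subst det_scale_rows_cols) (simp only: det_newton)
  also have "\<dots> = (\<Prod>i<n. R (i + m) * S i * (\<Prod>l<i. z (i + m) - z (l + m)))"
    by (simp only: prod.distrib)
  also have "\<dots> = (\<Prod>i<n. q ^ (m choose 2) * (P (2 * i + 2 * m + 1) * P (i + m) * Q i
                / (P (2 * i + 1) * P (i + 2 * m) * Q (i + m))))"
  proof (intro prod.cong refl)
    fix i
    \<comment> \<open>The power \<open>q ^ ((i + m) * i)\<close> is the one in
      \<open>prod_z_diff_shift\<close>; what remains is the same \<open>q ^ (m choose 2)\<close> for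
      every row.\<close>
    have e: "q ^ (i + m choose 2) * q ^ (Suc i choose 2) = q ^ (m choose 2) * q ^ ((i + m) * i)"
      using choose_two_diff[of i "i + m"] by (simp flip: power_add)
    define T where "T = (\<Prod>l<i. z (i + m) - z (l + m))"
    have T: "P (2 * i + 2 * m) * Q i = T * (P (i + 2 * m) * q ^ ((i + m) * i))"
      using prod_z_diff_shift[where i = i and m = m] by (simp add: T_def)
    have "R (i + m) * S i * T = (1 - Y * q ^ (2 * (i + m))) * P (i + m) / Q (i + m) / P (2 * i + 1) * T
        * (q ^ (i + m choose 2) * q ^ (Suc i choose 2))"
      by (simp add: R_def S_def)
    also have "\<dots> = q ^ (m choose 2) * ((P (2 * i + 2 * m) * Q i) * (1 - Y * q ^ (2 * (i + m))) * P (i + m)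
         / (P (2 * i + 1) * P (i + 2 * m) * Q (i + m)))"
      unfolding e T using P_nz[of "i + 2 * m"] by (simp add: mult_ac)
    also have "P (2 * i + 2 * m) * Q i * (1 - Y * q ^ (2 * (i + m))) = P (2 * i + 2 * m + 1) * Q i"
      by (simp add: qpoch_nat_Suc algebra_simps)
    finally show "R (i + m) * S i * T = q ^ (m choose 2) * (P (2 * i + 2 * m + 1) * P (i + m) * Q i
                / (P (2 * i + 1) * P (i + 2 * m) * Q (i + m)))"
      by (simp add: mult_ac)
  qed
  also have "\<dots> = (\<Prod>i<n. q ^ (m choose 2)) * (\<Prod>i<n. P (2 * i + 2 * m + 1) * P (i + m) * Q i
                / (P (2 * i + 1) * P (i + 2 * m) * Q (i + m)))"
    by (rule prod.distrib)
  finally show ?thesis by (simp add: power_mult mult.commute[of n])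
qed

section \<open>The determinant of \<open>H\<close>\<close>

definition H_gen :: "nat \<Rightarrow> nat \<Rightarrow> real mat" where
  "H_gen m n = mat m m (\<lambda>(i, j). if i \<le> n + j
     then P (2 * n + 2 * j + 1) / (P (n + i + j + 1) * Q (n + j - i)) else 0)"

text \<open>At \<open>q ^ N\<close> with \<open>i < m\<close> and \<open>i \<le> N\<close>, the two
  products become \<open>Q N / Q (N - i)\<close> and \<open>P (N + m) / P (N + i + 1)\<close>: the
  part of the entry that depends on the row, once the column factor
  \<open>1 / (P (N + m) * Q N)\<close> is taken out.\<close>

definition hpoly :: "nat \<Rightarrow> nat \<Rightarrow> real poly" where
  "hpoly m i = (\<Prod>l<i. [:1, - (1 / q ^ l):]) * (\<Prod>l\<in>{i+1..<m}. [:1, - (Y * q ^ l):])"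

lemma degree_hpoly: "i < m \<Longrightarrow> degree (hpoly m i) < m"
proof -
  assume i: "i < m"
  have "degree (\<Prod>l\<in>A. [:1, f l:]) \<le> card A" if "finite A" for A and f :: "nat \<Rightarrow> real"
  proof -
    have "degree (\<Prod>l\<in>A. [:1, f l:]) \<le> sum (degree \<circ> (\<lambda>l. [:1, f l:])) A"
      by (rule degree_prod_sum_le[OF that])
    also have "\<dots> \<le> (\<Sum>l\<in>A. 1)" by (intro sum_mono) auto
    finally show ?thesis by simp
  qed
  from this[of "{..<i}"] this[of "{i+1..<m}"] have
    "degree (\<Prod>l<i. [:1, - (1 / q ^ l):]) \<le> i"
    "degree (\<Prod>l\<in>{i+1..<m}. [:1, - (Y * q ^ l):]) \<le> m - (i + 1)" by auto
  with degree_mult_le[of "\<Prod>l<i. [:1, - (1 / q ^ l):]" "\<Prod>l\<in>{i+1..<m}. [:1, - (Y * q ^ l):]"] i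
  show ?thesis unfolding hpoly_def by linarith
qed

lemma Q_drop:
  assumes "i \<le> N"
  shows "(\<Prod>l<i. 1 - q ^ N / q ^ l) * Q (N - i) = Q N"
  using assms
proof (induction i)
  case (Suc i)
  define d where "d = N - Suc i"
  have N: "N = Suc (d + i)" using Suc.prems by (simp add: d_def)
  have d: "N - i = Suc d" "N - Suc i = d" using N by simp_all
  have "1 - q ^ N / q ^ i = 1 - q * q ^ d"
    using q by (simp add: N power_add)
  thus ?case using Suc by (simp add: d qpoch_nat_Suc mult_ac)
qed simp

lemma P_extend:
  assumes "i < m"
  shows "P (N + i + 1) * (\<Prod>l\<in>{i+1..<m}. 1 - Y * q ^ (N + l)) = P (N + m)"
proof -
  have "P (N + m) = P (N + i + 1) * qpoch_nat q (Y * q ^ (N + i + 1)) (m - (i + 1))"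
    using assms by (subst qpoch_nat_add[symmetric]) simp
  moreover have "(\<Prod>l\<in>{i+1..<m}. 1 - Y * q ^ (N + l)) = (\<Prod>l<m - (i + 1). 1 - Y * q ^ (N + i + 1) * q ^ l)"
    using assms
    by (intro prod.reindex_bij_witness[of _ "\<lambda>l. l + (i + 1)" "\<lambda>l. l - (i + 1)"])
       (auto simp add: mult.assoc simp del: power_Suc simp flip: power_add)
  ultimately show ?thesis by (simp add: qpoch_nat_def)
qed

lemma det_H_gen:
  "det (H_gen m n) = q ^ (n * (m choose 2)) *
     (\<Prod>j<m. P (2 * n + 2 * j + 1) * P (j + m) * Q j / (P (2 * j + 1) * P (n + j + m) * Q (n + j)))"
proof -
  define u where "u n j = P (2 * n + 2 * j + 1) / (P (n + j + m) * Q (n + j))" for n j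
  have entry: "(if i \<le> n + j then P (2 * n + 2 * j + 1) / (P (n + i + j + 1) * Q (n + j - i)) else 0)
      = u n j * poly (hpoly m i) (q ^ n * q ^ j)" if "i < m" for n i j
  proof (cases "i \<le> n + j")
    case True
    define A where "A = (\<Prod>l<i. 1 - q ^ (n + j) / q ^ l)"
    define D where "D = (\<Prod>l\<in>{i+1..<m}. 1 - Y * q ^ (n + j + l))"
    have p: "poly (hpoly m i) (q ^ n * q ^ j) = A * D"
      by (simp add: hpoly_def poly_prod power_add mult_ac A_def D_def)
    have QA: "Q (n + j) = A * Q (n + j - i)"
      using Q_drop[OF True] by (simp add: A_def)
    have PD: "P (n + j + m) = P (n + i + j + 1) * D"
      using P_extend[OF that, of "n + j"] by (simp add: add_ac D_def)
    have "A \<noteq> 0" "D \<noteq> 0" using QA PD Q_nz[of "n + j"] P_nz[of "n + j + m"] by auto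
    thus ?thesis using True unfolding u_def p QA PD by simp
  next
    case False
    \<comment> \<open>Here \<open>l = n + j\<close> lies in the range and gives the zero
      factor.\<close>
    hence "(\<Prod>l<i. 1 - q ^ (n + j) / q ^ l) = 0" using q by (intro prod_zero) auto
    thus ?thesis using False by (simp add: hpoly_def poly_prod power_add)
  qed
  have det_u: "det (H_gen m n) = (\<Prod>j<m. u n j) * det (mat m m (\<lambda>(j, i). poly (hpoly m i) (q ^ n * q ^ j)))"
    for n
  proof -
    \<comment> \<open>The transpose puts points in rows and polynomials in columns, as
      \<open>det_poly_eval\<close> has them.\<close>
    have "det (H_gen m n) = det (transpose_mat (H_gen m n))"
      by (rule det_transpose[symmetric, of _ m]) (simp add: H_gen_def)
    also have "transpose_mat (H_gen m n)
        = mat m m (\<lambda>(j, i). u n j * 1 * poly (hpoly m i) (q ^ n * q ^ j))"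
      by (rule eq_matI) (auto simp: H_gen_def entry[symmetric])
    finally show ?thesis by (subst (asm) det_scale_rows_cols) simp
  qed
  \<comment> \<open>The evaluation determinant at \<open>n = 0\<close> is never computed:
    unitriangularity forces it to be the inverse of the product of the \<open>u 0 j\<close>.\<close>
  have "det (H_gen m 0) = 1"
    unfolding H_gen_def using P_nz by (subst det_mat_upper) (auto simp: mult_2)
  with det_u[of 0] have 0: "(\<Prod>j<m. u 0 j) * det (mat m m (\<lambda>(j, i). poly (hpoly m i) (q ^ j))) = 1"
    by simp
  have "det (H_gen m n) = q ^ (n * (m choose 2)) * (\<Prod>j<m. u n j)
      * det (mat m m (\<lambda>(j, i). poly (hpoly m i) (q ^ j)))"
    using det_u[of n] det_poly_eval_dilate[of m "hpoly m" "q ^ n" "\<lambda>j. q ^ j"] degree_hpoly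
    by (simp add: power_mult)
  also have "det (mat m m (\<lambda>(j, i). poly (hpoly m i) (q ^ j))) = 1 / (\<Prod>j<m. u 0 j)"
    using 0 by (metis mult_eq_0_iff nonzero_eq_divide_eq mult.commute zero_neq_one)
  also have "q ^ (n * (m choose 2)) * (\<Prod>j<m. u n j) * (1 / (\<Prod>j<m. u 0 j))
     = q ^ (n * (m choose 2)) * (\<Prod>j<m. u n j / u 0 j)"
    by (simp add: prod_dividef)
  also have "(\<Prod>j<m. u n j / u 0 j) = (\<Prod>j<m. P (2 * n + 2 * j + 1) * P (j + m) * Q j / (P (2 * j + 1) * P (n + j + m) * Q (n + j)))"
    by (intro prod.cong refl) (simp add: u_def mult_ac)
  finally show ?thesis .
qed

section \<open>Exchanging products over \<open>n\<close> and over \<open>m\<close>\<close>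

lemma prod_shift:
  fixes f :: "nat \<Rightarrow> real"
  assumes "\<And>i. f i \<noteq> 0"
  shows "(\<Prod>i<n. f (i + k)) = (\<Prod>i<n + k. f i) / (\<Prod>i<k. f i)"
proof -
  have "(\<Prod>i<n + k. f i) = (\<Prod>i<k. f i) * (\<Prod>i<n. f (i + k))"
    by (induction n) (auto simp: mult_ac)
  thus ?thesis using assms by simp
qed

text \<open>By \<open>prod_shift\<close> both sides are the product of \<open>Q\<close> below
  \<open>n\<close> times that below \<open>m\<close>, over that below \<open>n + m\<close>.\<close>

lemma Q_prod_swap: "(\<Prod>i<n. Q i / Q (i + m)) = (\<Prod>j<m. Q j / Q (n + j))"
  using prod_shift[of Q n m] prod_shift[of Q m n] Q_nz
  by (simp add: prod_dividef add.commute)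

text \<open>Every factor is a shift of \<open>P\<close> or of \<open>E i = P (2 * i + 1)\<close>;
  \<open>prod_shift\<close> turns both sides into the same quotient of initial products.\<close>

lemma P_prod_swap:
  "(\<Prod>i<n. P (2 * i + 2 * m + 1) * P (i + m) / (P (2 * i + 1) * P (i + 2 * m)))
    = (\<Prod>j<m. P (2 * n + 2 * j + 1) * P (j + m) / (P (2 * j + 1) * P (n + j + m)))"
proof -
  define E where "E i = P (2 * i + 1)" for i
  have E: "P (2 * i + 2 * k + 1) = E (i + k)" "P (2 * i + 1) = E i" for i k by (simp_all add: E_def)
  have nz: "E i \<noteq> 0" "prod E {..<i} \<noteq> 0" "prod P {..<i} \<noteq> 0" for i
    using P_nz by (auto simp: E_def)
  have "P (2 * n + 2 * j + 1) = E (j + n)" "P (n + j + m) = P (j + (n + m))" for j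
    by (simp_all add: E_def add_ac)
  moreover have "P (i + 2 * m) = P (i + (m + m))" for i by (simp add: mult_2)
  ultimately show ?thesis
    unfolding E using nz
    by (simp only: prod_dividef prod.distrib prod_shift[of E, OF nz(1)] prod_shift[of P, OF P_nz])
       (simp add: field_simps)
qed

end


section \<open>From real exponents to natural powers of \<open>q\<close>\<close>

lemma binom2_of_nat: "binom2 (real k) = real (k choose 2)"
  by (induction k) (auto simp: binom2_def numeral_2_eq_2 field_simps)

lemma powr_binom2: "0 < q \<Longrightarrow> q powr binom2 (real k) = q ^ (k choose 2)"
  by (simp add: binom2_of_nat powr_realpow)

lemma qfact_eq:
  assumes "0 < q"
  shows "qfact q r = qpoch_nat q q r / (1 - q) ^ r"
proof (induction r)
  case (Suc r)
  have "qnum q (real (Suc r)) = (1 - q * q ^ r) / (1 - q)"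
    using assms by (subst qnum_def, subst powr_realpow) simp_all
  thus ?case using Suc by (simp add: qfact_def qpoch_nat_Suc)
qed (simp add: qfact_def)

lemma qbinom_eq:
  assumes "0 < q"
  shows "qbinom q y (int r) = qpoch_nat q (q powr (y - real r + 1)) r / qpoch_nat q q r"
proof -
  have *: "q powr (y - real r + real (Suc l)) = q powr (y - real r + 1) * q ^ l" for l
  proof -
    have "y - real r + real (Suc l) = (y - real r + 1) + real l" by simp
    thus ?thesis using assms by (simp only: powr_add powr_realpow)
  qed
  have "{1..r} = Suc ` {..<r}" by (simp add: image_Suc_lessThan)
  thus ?thesis
    by (simp add: qbinom_def qpoch_nat_def prod.reindex prod_dividef * del: of_nat_Suc)
qed

text \<open>One quotient serves both signs of \<open>r\<close>: for negative \<open>r\<close> the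
  definition inverts the block of factors of \<open>P a\<close> that lie beyond
  \<open>P (nat (int a + r))\<close>.\<close>

lemma (in generic_qpoch) qpoch_shift:
  assumes "int a + r \<ge> 0"
  shows "qpoch q (Y * q ^ a) r = P (nat (int a + r)) / P a"
proof (cases "r \<ge> 0")
  case True
  thus ?thesis
    using P_nz[of a] qpoch_nat_add[of q Y a "nat r"] by (simp add: qpoch_def nat_add_distrib)
next
  case False
  define b where "b = nat (int a + r)"
  have a: "a = b + nat (- r)" using False assms by (simp add: b_def)
  have "q ^ a * q powi r = q powi (int a + r)" using q by (simp add: power_int_add)
  also have "\<dots> = q ^ b" using assms by (simp add: b_def power_int_def)
  finally have "qpoch q (Y * q ^ a) r = 1 / qpoch_nat q (Y * q ^ b) (nat (- r))"
    using False by (simp add: qpoch_def mult.assoc)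
  moreover have "P a = P b * qpoch_nat q (Y * q ^ b) (nat (- r))"
    using qpoch_nat_add[of q Y b "nat (- r)"] a by simp
  ultimately show ?thesis using P_nz[of b] by (simp flip: b_def)
qed

text \<open>The closed form is named so that it can be treated as a function of \<open>x\<close> in
  the continuity argument.\<close>

definition det_value :: "real \<Rightarrow> real \<Rightarrow> nat \<Rightarrow> nat \<Rightarrow> real" where
  "det_value q x m n = q powr (real n * binom2 (real m)) * (1 / (1 - q) ^ (m * n))
             * (\<Prod>j<m. qfact q j / qfact q (n + j))
             * (\<Prod>j=1..n. qpoch q (q powr (x + 2 * real j - 2)) (int m - int j)
                          * qpoch q (q powr (x + 2 * real m + real j - 2)) (int j))"

section \<open>Both determinants for non-integer \<open>x\<close>\<close>

locale noninteger_exponent =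
  fixes q x :: real
  assumes q: "0 < q" "q < 1" and x: "x \<notin> \<int>"
begin

text \<open>The exponent is matched through an equation, so that it may come in any arithmetic
  form.\<close>

lemma powr_shift: "y = x - 1 + real k \<Longrightarrow> q powr y = q powr (x - 1) * q ^ k"
  using q by (simp add: powr_add powr_realpow)

sublocale generic_qpoch q "q powr (x - 1)"
proof
  fix k
  have "x - 1 + real k \<noteq> 0"
  proof
    assume "x - 1 + real k = 0"
    hence "x = of_int (1 - int k)" by simp
    thus False using x by (metis Ints_of_int)
  qed
  thus "q powr (x - 1) * q ^ k \<noteq> 1"
    using q powr_shift[OF refl, of k] powr_eq_one_iff_gen[of q "x - 1 + real k"] by simp
qed (use q in auto)

lemma B_mat_eq: "B_mat n x m q = B_gen n m"
proof (rule eq_matI)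
  fix i j assume "i < dim_row (B_gen n m)" "j < dim_col (B_gen n m)"
  hence ij: "i < n" "j < n" by (simp_all add: B_gen_def)
  show "B_mat n x m q $$ (i, j) = B_gen n m $$ (i, j)"
  proof (cases "j \<le> i + m")
    case True
    define r where "r = i + m - j"
    have r: "int i - int j + int m = int r" using True by (simp add: r_def)
    have m: "real m = real r + real j - real i" using True by (simp add: r_def)
    have jr: "Suc (2 * j) + r = Suc (i + m + j)" using True by (simp add: r_def)
    have "q powr (real i + real j + x + real m - 1 - real r + 1) = q powr (x - 1) * q ^ Suc (2 * j)"
      by (intro powr_shift) (simp add: m)
    moreover have P: "P (2 * j + 1) * qpoch_nat q (q powr (x - 1) * q ^ Suc (2 * j)) r = P (Suc (i + m + j))"
      using qpoch_nat_add[of q "q powr (x - 1)" "Suc (2 * j)" r] unfolding jr by simp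
    ultimately have 1: "qbinom q (real i + real j + x + real m - 1) (int r)
        = P (Suc (i + m + j)) / (P (2 * j + 1) * Q r)"
      using P_nz[of "2 * j + 1"] by (simp only: qbinom_eq[OF q(1)] flip: P) simp
    have 2: "q powr (2 * real i + x + 2 * real m - 1) = q powr (x - 1) * q ^ (2 * (i + m))"
      "q powr (real i + real j + x + real m - 1) = q powr (x - 1) * q ^ (i + m + j)"
      by (rule powr_shift, simp)+
    have 3: "q powr binom2 (of_int (int r)) = q ^ (r choose 2)"
      using powr_binom2[OF q(1), of r] by simp
    \<comment> \<open>Up to \<open>1 - q\<close>, this is the denominator of the entry, and it is
      also the last factor of the numerator of the q-binomial.\<close>
    define a where "a = 1 - q powr (x - 1) * q ^ (i + m + j)"
    have a: "a \<noteq> 0" "P (Suc (i + m + j)) = P (i + m + j) * a"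
      using Y[of "i + m + j"] by (simp_all add: a_def qpoch_nat_Suc)
    have "B_mat n x m q $$ (i, j) = q ^ (r choose 2)
        * ((1 - q powr (x - 1) * q ^ (2 * (i + m))) / (1 - q) / (a / (1 - q)))
        * (P (i + m + j) * a / (P (2 * j + 1) * Q r))"
      using ij by (simp only: B_mat_def index_mat prod.case r 1 2 3 qnum_def a(2) flip: a_def)
    also have "\<dots> = (1 - q powr (x - 1) * q ^ (2 * (i + m))) * q ^ (r choose 2) * P (i + m + j)
        / (P (2 * j + 1) * Q r)"
      using a(1) q(2) by simp
    also have "\<dots> = B_gen n m $$ (i, j)"
      using ij True by (simp only: B_gen_def index_mat prod.case if_True r_def)
    finally show ?thesis .
  next
    case False
    thus ?thesis using ij by (simp add: B_mat_def B_gen_def qbinom_def)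
  qed
qed (simp_all add: B_mat_def B_gen_def)

lemma H_mat_eq: "H_mat m x n q = H_gen m n"
proof (rule eq_matI)
  fix i j assume "i < dim_row (H_gen m n)" "j < dim_col (H_gen m n)"
  hence ij: "i < m" "j < m" by (simp_all add: H_gen_def)
  show "H_mat m x n q $$ (i, j) = H_gen m n $$ (i, j)"
  proof (cases "i \<le> n + j")
    case True
    define r where "r = n + j - i"
    have r: "int n - int i + int j = int r" using True by (simp add: r_def)
    have n: "real n = real r + real i - real j" using True by (simp add: r_def)
    have jr: "Suc (n + i + j) + r = 2 * n + 2 * j + 1" using True by (simp add: r_def)
    have "q powr (2 * of_int (int r) + (x + 2 * real i) - 1 - real r + 1)
        = q powr (x - 1) * q ^ Suc (n + i + j)"
      by (intro powr_shift) (simp add: n)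
    moreover have P: "P (n + i + j + 1) * qpoch_nat q (q powr (x - 1) * q ^ Suc (n + i + j)) r
        = P (2 * n + 2 * j + 1)"
      using qpoch_nat_add[of q "q powr (x - 1)" "Suc (n + i + j)" r] unfolding jr by simp
    ultimately have "hq q (int r) (x + 2 * real i) = P (2 * n + 2 * j + 1) / (P (n + i + j + 1) * Q r)"
      using P_nz[of "n + i + j + 1"]
      by (simp only: hq_def qbinom_eq[OF q(1)] flip: P) simp
    thus ?thesis
      using ij True unfolding H_mat_def H_gen_def by (simp add: r flip: r_def)
  next
    case False
    thus ?thesis using ij by (simp add: H_mat_def H_gen_def hq_def qbinom_def)
  qed
qed (simp_all add: H_mat_def H_gen_def)

lemma det_value_eq:
  "det_value q x m n = q ^ (n * (m choose 2)) * (\<Prod>j<m. Q j / Q (n + j)) *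
     (\<Prod>i<n. P (2 * i + 2 * m + 1) * P (i + m) / (P (2 * i + 1) * P (i + 2 * m)))"
proof -
  have 1: "q powr (real n * binom2 (real m)) = q ^ (n * (m choose 2))"
    using q powr_realpow[of q "n * (m choose 2)"] by (simp add: binom2_of_nat)
  \<comment> \<open>Each of the \<open>m\<close> quotients yields \<open>(1 - q) ^ n\<close>, which
    together cancel the prefactor \<open>1 / (1 - q) ^ (m * n)\<close>.\<close>
  have "(\<Prod>j<m. qfact q j / qfact q (n + j)) = (\<Prod>j<m. Q j / Q (n + j) * (1 - q) ^ n)"
    using q by (intro prod.cong refl) (simp add: qfact_eq power_add)
  also have "\<dots> = (\<Prod>j<m. Q j / Q (n + j)) * (1 - q) ^ (m * n)"
    by (subst prod.distrib) (simp add: mult.commute[of m] power_mult)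
  finally have 2: "(\<Prod>j<m. qfact q j / qfact q (n + j))
      = (\<Prod>j<m. Q j / Q (n + j)) * (1 - q) ^ (m * n)" .
  have "{1..n} = Suc ` {..<n}" by (simp add: image_Suc_lessThan)
  hence "(\<Prod>j=1..n. qpoch q (q powr (x + 2 * real j - 2)) (int m - int j)
                          * qpoch q (q powr (x + 2 * real m + real j - 2)) (int j))
    = (\<Prod>i<n. qpoch q (q powr (x + 2 * real (Suc i) - 2)) (int m - int (Suc i))
                          * qpoch q (q powr (x + 2 * real m + real (Suc i) - 2)) (int (Suc i)))"
    by (simp add: prod.reindex del: of_nat_Suc)
  also have "\<dots> = (\<Prod>i<n. P (2 * i + 2 * m + 1) * P (i + m) / (P (2 * i + 1) * P (i + 2 * m)))"
  proof (intro prod.cong refl)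
    fix i
    have "q powr (x + 2 * real (Suc i) - 2) = q powr (x - 1) * q ^ (2 * i + 1)"
      "q powr (x + 2 * real m + real (Suc i) - 2) = q powr (x - 1) * q ^ (i + 2 * m)"
      by (rule powr_shift, simp)+
    moreover have "qpoch q (q powr (x - 1) * q ^ (2 * i + 1)) (int m - int (Suc i)) = P (i + m) / P (2 * i + 1)"
      \<comment> \<open>The index \<open>m - (i + 1)\<close> may be negative, but added to
        \<open>2 * i + 1\<close> it gives \<open>i + m\<close>.\<close>
      by (subst qpoch_shift) (simp_all add: nat_add_distrib)
    moreover have "qpoch q (q powr (x - 1) * q ^ (i + 2 * m)) (int (Suc i)) = P (2 * i + 2 * m + 1) / P (i + 2 * m)"
    proof (subst qpoch_shift)
      have "nat (int (i + 2 * m) + int (Suc i)) = 2 * i + 2 * m + 1" by simp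
      thus "P (nat (int (i + 2 * m) + int (Suc i))) / P (i + 2 * m) = P (2 * i + 2 * m + 1) / P (i + 2 * m)"
        by (simp only:)
    qed simp
    ultimately show "qpoch q (q powr (x + 2 * real (Suc i) - 2)) (int m - int (Suc i))
                          * qpoch q (q powr (x + 2 * real m + real (Suc i) - 2)) (int (Suc i))
        = P (2 * i + 2 * m + 1) * P (i + m) / (P (2 * i + 1) * P (i + 2 * m))"
      by (simp only:) simp
  qed
  finally show ?thesis unfolding det_value_def 1 2 using q by simp
qed

lemma det_B_mat_eq_det_value: "det (B_mat n x m q) = det_value q x m n"
proof -
  define a where "a i = P (2 * i + 2 * m + 1) * P (i + m)" for i
  define b where "b i = P (2 * i + 1) * P (i + 2 * m)" for i
  have "det (B_mat n x m q) = q ^ (n * (m choose 2)) * (\<Prod>i<n. a i * Q i / (b i * Q (i + m)))"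
    unfolding B_mat_eq a_def b_def by (rule det_B_gen)
  also have "(\<Prod>i<n. a i * Q i / (b i * Q (i + m))) = (\<Prod>i<n. a i / b i) * (\<Prod>i<n. Q i / Q (i + m))"
    by (simp only: prod_dividef prod.distrib times_divide_times_eq)
  also have "(\<Prod>i<n. Q i / Q (i + m)) = (\<Prod>j<m. Q j / Q (n + j))"
    by (rule Q_prod_swap)
  finally have "det (B_mat n x m q)
      = q ^ (n * (m choose 2)) * (\<Prod>j<m. Q j / Q (n + j)) * (\<Prod>i<n. a i / b i)"
    by (simp only: mult_ac)
  thus ?thesis by (simp only: det_value_eq a_def b_def)
qed

lemma det_H_mat_eq_det_value: "det (H_mat m x n q) = det_value q x m n"
proof -
  define a where "a j = P (2 * n + 2 * j + 1) * P (j + m)" for j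
  define b where "b j = P (2 * j + 1) * P (n + j + m)" for j
  have "det (H_mat m x n q) = q ^ (n * (m choose 2)) * (\<Prod>j<m. a j * Q j / (b j * Q (n + j)))"
    unfolding H_mat_eq a_def b_def by (rule det_H_gen)
  also have "(\<Prod>j<m. a j * Q j / (b j * Q (n + j))) = (\<Prod>j<m. a j / b j) * (\<Prod>j<m. Q j / Q (n + j))"
    by (simp only: prod_dividef prod.distrib times_divide_times_eq)
  finally have "det (H_mat m x n q)
      = q ^ (n * (m choose 2)) * (\<Prod>j<m. Q j / Q (n + j)) * (\<Prod>j<m. a j / b j)"
    by (simp only: mult_ac)
  also have "(\<Prod>j<m. a j / b j)
      = (\<Prod>i<n. P (2 * i + 2 * m + 1) * P (i + m) / (P (2 * i + 1) * P (i + 2 * m)))"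
    unfolding a_def b_def by (rule P_prod_swap[symmetric])
  finally show ?thesis by (simp only: det_value_eq)
qed

end

section \<open>Continuity in \<open>x\<close> and passage to integer values\<close>

text \<open>The Leibniz formula makes the determinant a polynomial in the entries.\<close>

lemma isCont_det:
  fixes f :: "'a :: t2_space \<Rightarrow> nat \<Rightarrow> nat \<Rightarrow> real"
  assumes "\<And>i j. i < n \<Longrightarrow> j < n \<Longrightarrow> isCont (\<lambda>x. f x i j) a"
  shows "isCont (\<lambda>x. det (mat n n (\<lambda>(i, j). f x i j))) a"
proof -
  have "p i < n" if "p permutes {0..<n}" "i < n" for p i
    using permutes_in_image[OF that(1), of i] that(2) by simp
  hence "det (mat n n (\<lambda>(i, j). f x i j))
      = (\<Sum>p | p permutes {0..<n}. signof p * (\<Prod>i = 0..<n. f x i (p i)))" for x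
    by (subst det_def'[of _ n]) auto
  thus ?thesis
    using \<open>\<And>p i. p permutes {0..<n} \<Longrightarrow> i < n \<Longrightarrow> p i < n\<close>
    by (auto intro!: continuous_intros assms)
qed

lemma isCont_powr_const:
  fixes q :: real
  assumes "q > 0" "isCont f a"
  shows "isCont (\<lambda>x. q powr f x) a"
  using assms by (intro continuous_at_within_powr) auto

lemma isCont_qbinom:
  assumes "0 < q" "q < 1" "isCont f a"
  shows "isCont (\<lambda>x. qbinom q (f x) r) a"
proof -
  have "q ^ l \<noteq> 1" if "l \<in> {1..nat r}" for l
    using that assms power_less_one_iff[of q l] by simp
  thus ?thesis
    unfolding qbinom_def using assms
    by (cases "r \<ge> 0") (auto intro!: continuous_intros isCont_powr_const)
qed

lemma isCont_qpoch:
  assumes "isCont f a" "r < 0 \<Longrightarrow> qpoch_nat q (f a * q powi r) (nat (- r)) \<noteq> 0"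
  shows "isCont (\<lambda>x. qpoch q (f x) r) a"
  using assms unfolding qpoch_def qpoch_nat_def
  by (cases "r \<ge> 0") (auto intro!: continuous_intros)

text \<open>Strictly between \<open>a\<close> and \<open>\<lfloor>a\<rfloor> + 1\<close> there is no
  integer, so the limits of \<open>f\<close> and \<open>g\<close> from the right agree.\<close>

lemma isCont_eq_off_Ints:
  fixes f g :: "real \<Rightarrow> real"
  assumes "isCont f a" "isCont g a" "\<And>x. x \<notin> \<int> \<Longrightarrow> f x = g x"
  shows "f a = g a"
proof -
  have "eventually (\<lambda>x. x \<in> {a<..<of_int \<lfloor>a\<rfloor> + 1}) (at_right a)"
    by (rule eventually_at_right_real) linarith
  hence "eventually (\<lambda>x. f x = g x) (at_right a)"
  proof eventually_elim
    case (elim x)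
    have "x \<notin> \<int>"
    proof
      assume "x \<in> \<int>"
      then obtain k where "x = of_int k" by (auto elim: Ints_cases)
      moreover from this elim have "k < \<lfloor>a\<rfloor> + 1" by (simp flip: of_int_less_iff)
      hence "of_int k \<le> a" by (simp flip: le_floor_iff)
      ultimately show False using elim by simp
    qed
    thus ?case by (rule assms)
  qed
  moreover have "(f \<longlongrightarrow> f a) (at_right a)" "(g \<longlongrightarrow> g a) (at_right a)"
    using assms by (auto simp: isCont_def filterlim_at_split)
  ultimately show ?thesis
    using tendsto_cong tendsto_unique trivial_limit_at_right_real by metis
qed

context
  fixes q x :: real and m n :: nat
  assumes q: "0 < q" "q < 1"
    and x: "\<And>i j. i < n \<Longrightarrow> j < n \<Longrightarrow> x + real i + real j + real m - 1 \<noteq> 0"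
begin

lemma isCont_det_B_mat: "isCont (\<lambda>x. det (B_mat n x m q)) x"
proof -
  have "qnum q (real i + real j + x + real m - 1) \<noteq> 0" if "i < n" "j < n" for i j
    using x[OF that] q by (auto simp: qnum_def powr_eq_one_iff_gen algebra_simps)
  thus ?thesis
    unfolding B_mat_def qnum_def using q
    by (intro isCont_det continuous_intros isCont_qbinom isCont_powr_const) auto
qed

lemma isCont_det_H_mat: "isCont (\<lambda>x. det (H_mat m x n q)) x"
  unfolding H_mat_def hq_def using q
  by (intro isCont_det continuous_intros isCont_qbinom)

lemma isCont_det_value: "isCont (\<lambda>x. det_value q x m n) x"
proof -
  \<comment> \<open>Denominators depending on \<open>x\<close> arise only from negative indices
    \<open>m - j\<close>. Their factors are \<open>1 - q powr (x + (j - 1) + l + m - 1)\<close> with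
    \<open>l < j - m\<close>, so the hypothesis at the index pair \<open>j - 1\<close>,
    \<open>l\<close> excludes zeros.\<close>
  have "qpoch_nat q (q powr (x + 2 * real j - 2) * q powi (int m - int j)) (nat (- (int m - int j))) \<noteq> 0"
    if j: "j \<in> {1..n}" "int m - int j < 0" for j
  proof -
    have powi: "q powi k = q powr of_int k" for k
      using q by (simp add: powr_real_of_int')
    have "q powr (x + 2 * real j - 2) * q powi (int m - int j) * q ^ l \<noteq> 1" if l: "l < j - m" for l
    proof -
      have "q powr (x + 2 * real j - 2) * q powi (int m - int j) * q ^ l
          = q powr (x + 2 * real j - 2) * q powr of_int (int m - int j) * q powr real l"
        using q by (simp only: powi powr_realpow)
      also have "\<dots> = q powr (x + real (j - 1) + real l + real m - 1)"
        using j by (simp add: of_nat_diff algebra_simps flip: powr_add)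
      finally show ?thesis
        using x[of "j - 1" l] j l q by (simp add: powr_eq_one_iff_gen)
    qed
    thus ?thesis using j by (auto simp: qpoch_nat_def nat_diff_distrib)
  qed
  thus ?thesis
    unfolding det_value_def using q
    by (intro continuous_intros isCont_qpoch isCont_powr_const) auto
qed

end

theorem theorem11:
  fixes q x :: real and m n :: nat
  assumes "0 < q" and "q < 1"
    and "\<And>i j. i < n \<Longrightarrow> j < n \<Longrightarrow> x + real i + real j + real m - 1 \<noteq> 0"
  shows "det (B_mat n x m q)
           = q powr (real n * binom2 (real m)) * (1 / (1 - q) ^ (m * n))
             * (\<Prod>j<m. qfact q j / qfact q (n + j))
             * (\<Prod>j=1..n. qpoch q (q powr (x + 2 * real j - 2)) (int m - int j)
                          * qpoch q (q powr (x + 2 * real m + real j - 2)) (int j))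
         \<and> q powr (real n * binom2 (real m)) * (1 / (1 - q) ^ (m * n))
             * (\<Prod>j<m. qfact q j / qfact q (n + j))
             * (\<Prod>j=1..n. qpoch q (q powr (x + 2 * real j - 2)) (int m - int j)
                          * qpoch q (q powr (x + 2 * real m + real j - 2)) (int j))
           = det (H_mat m x n q)"
proof -
  have B: "isCont (\<lambda>x. det (B_mat n x m q)) x"
    and H: "isCont (\<lambda>x. det (H_mat m x n q)) x"
    and D: "isCont (\<lambda>x. det_value q x m n) x"
    using assms by (blast intro: isCont_det_B_mat isCont_det_H_mat isCont_det_value)+
  have "det (B_mat n y m q) = det_value q y m n" "det (H_mat m y n q) = det_value q y m n"
    if "y \<notin> \<int>" for y
  proof -
    interpret noninteger_exponent q y using assms(1,2) that by unfold_locales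
    show "det (B_mat n y m q) = det_value q y m n" "det (H_mat m y n q) = det_value q y m n"
      by (rule det_B_mat_eq_det_value det_H_mat_eq_det_value)+
  qed
  hence "det (B_mat n x m q) = det_value q x m n" "det_value q x m n = det (H_mat m x n q)"
    using isCont_eq_off_Ints[OF B D] isCont_eq_off_Ints[OF H D] by simp_all
  thus ?thesis unfolding det_value_def by (rule conjI)
qed

end
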